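(* For any finite simple graph $G$ with at least one edge and any positive integer $p$, $r_p(G)\le\mu_p(G)$, with equality if $r_p(G)=1$.
   Context: For a graph $G=(V,E)$, $N_G(x)$ denotes the neighbourhood of $x$. A set $D\subseteq V$ is a $p$-dominating set if every vertex $x\notin D$ has at least $p$ neighbours in $D$; $\gamma_p(G)$ is the minimum size of a $p$-dominating set, and a $\gamma_p$-set is a $p$-dominating set of that size. For $B\subseteq E(G^c)$ (edges of the complement), $G+B=(V,E\cup B)$. The $p$-reinforcement number is $r_p(G)=\min\{|B| : B\subseteq E(G^c),\ \gamma_p(G+B)<\gamma_p(G)\}$, with the convention $r_p(G)=0$ if $\gamma_p(G)\le p$. For $X\subseteq V$ and $x\in X$, a vertex $y\notin X$ is a $p$-private neighbour of $x$ with respect to $X$ if $xy\in E$ and $|N_G(y)\cap X|=p$; $PN_p(x,X,G)$ is the set of such $y$. Define $\mu_p(x,X,G)=|PN_p(x,X,G)|+\max\{0,p-|N_G(x)\cap X|\}$, $\mu_p(X,G)=\min\{\mu_p(x,X,G): x\in X\}$, and $\mu_p(G)=\min\{\mu_p(X,G) : X \text{ is a } \gamma_p\text{-set of } G\}$. *)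

theory Defs
  imports Main
begin

definition finite_simple_graph :: "'a set \<Rightarrow> 'a set set \<Rightarrow> bool" where
  "finite_simple_graph V E \<longleftrightarrow> finite V \<and> (\<forall>e\<in>E. e \<subseteq> V \<and> card e = 2)"

definition complement_edges :: "'a set \<Rightarrow> 'a set set \<Rightarrow> 'a set set" where
  "complement_edges V E = {e. e \<subseteq> V \<and> card e = 2 \<and> e \<notin> E}"

definition neighbourhood :: "'a set set \<Rightarrow> 'a \<Rightarrow> 'a set" where
  "neighbourhood E x = {y. {x, y} \<in> E}"

definition p_dominating :: "nat \<Rightarrow> 'a set \<Rightarrow> 'a set set \<Rightarrow> 'a set \<Rightarrow> bool" where
  "p_dominating p V E D \<longleftrightarrow>
     D \<subseteq> V \<and> (\<forall>x\<in>V - D. p \<le> card (neighbourhood E x \<inter> D))"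

definition p_domination_number :: "nat \<Rightarrow> 'a set \<Rightarrow> 'a set set \<Rightarrow> nat" where
  "p_domination_number p V E = Min {card D |D. p_dominating p V E D}"

definition is_gamma_set :: "nat \<Rightarrow> 'a set \<Rightarrow> 'a set set \<Rightarrow> 'a set \<Rightarrow> bool" where
  "is_gamma_set p V E X \<longleftrightarrow>
     p_dominating p V E X \<and> card X = p_domination_number p V E"

definition p_reinforcement_number :: "nat \<Rightarrow> 'a set \<Rightarrow> 'a set set \<Rightarrow> nat" where
  "p_reinforcement_number p V E =
     (if p_domination_number p V E \<le> p then 0
      else Min {card B |B. B \<subseteq> complement_edges V E \<and>
                  p_domination_number p V (E \<union> B) < p_domination_number p V E})"

definition private_neighbours ::
  "nat \<Rightarrow> 'a set \<Rightarrow> 'a set set \<Rightarrow> 'a \<Rightarrow> 'a set \<Rightarrow> 'a set" where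
  "private_neighbours p V E x X =
     {y \<in> V - X. {x, y} \<in> E \<and> card (neighbourhood E y \<inter> X) = p}"

text \<open>Subtraction on type \<open>nat\<close> is truncated, so \<open>p - k\<close> below is the maximum of \<open>0\<close>
  and the integer difference.\<close>

definition mu_vertex :: "nat \<Rightarrow> 'a set \<Rightarrow> 'a set set \<Rightarrow> 'a \<Rightarrow> 'a set \<Rightarrow> nat" where
  "mu_vertex p V E x X =
     card (private_neighbours p V E x X) + (p - card (neighbourhood E x \<inter> X))"

definition mu_set :: "nat \<Rightarrow> 'a set \<Rightarrow> 'a set set \<Rightarrow> 'a set \<Rightarrow> nat" where
  "mu_set p V E X = Min {mu_vertex p V E x X |x. x \<in> X}"

definition mu_graph :: "nat \<Rightarrow> 'a set \<Rightarrow> 'a set set \<Rightarrow> nat" where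
  "mu_graph p V E = Min {mu_set p V E X |X. is_gamma_set p V E X}"

end

theory Submission
  imports Defs
begin

text \<open>Let \<open>\<gamma>\<^sub>p(G) > p\<close>. For the inequality, remove a vertex \<open>x\<close> from a \<open>\<gamma>\<^sub>p\<close>-set \<open>X\<close>. The only
  vertices that \<open>X - {x}\<close> may fail to \<open>p\<close>-dominate are the \<open>p\<close>-private neighbours of \<open>x\<close>, each
  of which lacks one neighbour, and \<open>x\<close> itself, which lacks \<open>max 0 (p - |N(x) \<inter> X|)\<close> of them. As
  \<open>|X| > p\<close>, there are enough non-neighbours in \<open>X - {x}\<close> to repair this with \<open>\<mu>\<^sub>p(x, X, G)\<close>
  new edges. Conversely, if a single new edge \<open>uv\<close> lowers \<open>\<gamma>\<^sub>p\<close>, a minimum \<open>p\<close>-dominating set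
  \<open>D\<close> of \<open>G + uv\<close> contains exactly one end, say \<open>v\<close>; then \<open>X = D \<union> {u}\<close> is a \<open>\<gamma>\<^sub>p\<close>-set of \<open>G\<close>
  with \<open>\<mu>\<^sub>p(u, X, G) = 1\<close>.\<close>

lemma p_dominating_finite: "finite V \<Longrightarrow> p_dominating p V E D \<Longrightarrow> finite D"
  by (auto simp: p_dominating_def intro: finite_subset)

lemma finite_p_dominating: "finite V \<Longrightarrow> finite {D. p_dominating p V E D}"
  by (rule finite_subset[of _ "Pow V"]) (auto simp: p_dominating_def)

lemma finite_gamma_sets: "finite V \<Longrightarrow> finite {X. is_gamma_set p V E X}"
  by (rule finite_subset[OF _ finite_p_dominating]) (auto simp: is_gamma_set_def)

lemma p_domination_number_le:
  assumes "finite V" "p_dominating p V E D"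
  shows "p_domination_number p V E \<le> card D"
  unfolding p_domination_number_def
  using assms finite_p_dominating[of V p E] by (intro Min_le) auto

lemma gamma_set_exists:
  assumes "finite V"
  obtains D where "is_gamma_set p V E D"
proof -
  have "p_dominating p V E V"
    by (simp add: p_dominating_def)
  then have "p_domination_number p V E \<in> {card D |D. p_dominating p V E D}"
    unfolding p_domination_number_def
    using finite_p_dominating[OF assms, of p E] by (intro Min_in) auto
  then show thesis
    using that by (auto simp: is_gamma_set_def)
qed

lemma mu_set_le_mu_vertex:
  assumes "finite X" "x \<in> X"
  shows "mu_set p V E X \<le> mu_vertex p V E x X"
  unfolding mu_set_def using assms by (intro Min_le) auto

lemma mu_graph_le_mu_vertex:
  assumes "finite V" "is_gamma_set p V E X" "x \<in> X"
  shows "mu_graph p V E \<le> mu_vertex p V E x X"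
proof -
  have "finite X"
    using assms p_dominating_finite[of V p E X] unfolding is_gamma_set_def by blast
  moreover have "mu_graph p V E \<le> mu_set p V E X"
    unfolding mu_graph_def using assms finite_gamma_sets[of V p E] by (intro Min_le) auto
  ultimately show ?thesis
    using mu_set_le_mu_vertex[OF _ assms(3)] le_trans by blast
qed

text \<open>With a positive domination number every \<gamma>-set is nonempty, so the inner
  \<open>Min\<close> over the vertices of a \<gamma>-set is a genuine minimum.\<close>

lemma mu_graph_attained:
  assumes "finite V" "p_domination_number p V E > 0"
  obtains X x where "is_gamma_set p V E X" "x \<in> X" "mu_graph p V E = mu_vertex p V E x X"
proof -
  obtain Y where "is_gamma_set p V E Y"
    using gamma_set_exists[OF assms(1)] .
  then have "mu_graph p V E \<in> {mu_set p V E X |X. is_gamma_set p V E X}"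
    unfolding mu_graph_def
    using finite_gamma_sets[OF assms(1), of p E] by (intro Min_in) auto
  then obtain X where X: "is_gamma_set p V E X" "mu_graph p V E = mu_set p V E X"
    by auto
  have "finite X"
    using assms X p_dominating_finite[of V p E X] unfolding is_gamma_set_def by blast
  moreover have "X \<noteq> {}"
    using X assms(2) by (auto simp: is_gamma_set_def)
  ultimately have "mu_set p V E X \<in> {mu_vertex p V E x X |x. x \<in> X}"
    unfolding mu_set_def by (intro Min_in) auto
  then show thesis
    using X that by auto
qed

lemma finite_complement_edges: "finite V \<Longrightarrow> finite (complement_edges V E)"
  by (rule finite_subset[of _ "Pow V"]) (auto simp: complement_edges_def)

lemma finite_reinforcements:
  assumes "finite V"
  shows "finite {card B |B. B \<subseteq> complement_edges V E \<and> P B}"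
  using finite_complement_edges[OF assms, of E]
  by (rule finite_surj[OF finite_Pow_iff[THEN iffD2], of _ _ card]) auto

lemma p_reinforcement_number_le:
  assumes "finite V" "B \<subseteq> complement_edges V E"
    and "p_domination_number p V (E \<union> B) < p_domination_number p V E"
  shows "p_reinforcement_number p V E \<le> card B"
  unfolding p_reinforcement_number_def
  using assms finite_reinforcements[OF assms(1)] by (auto intro!: Min_le)

text \<open>The reinforcing set \<open>B\<close> shows that the minimum ranges over a nonempty
  set.\<close>

lemma p_reinforcement_number_attained:
  assumes "finite V" "p < p_domination_number p V E"
    and "B \<subseteq> complement_edges V E" "p_domination_number p V (E \<union> B) < p_domination_number p V E"
  obtains C where "C \<subseteq> complement_edges V E" "card C = p_reinforcement_number p V E"
    "p_domination_number p V (E \<union> C) < p_domination_number p V E"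
proof -
  have "p_reinforcement_number p V E \<in> {card B |B. B \<subseteq> complement_edges V E \<and>
      p_domination_number p V (E \<union> B) < p_domination_number p V E}"
    using assms(2) assms(3,4)
      Min_in[OF finite_reinforcements[OF assms(1), of E
        "\<lambda>B. p_domination_number p V (E \<union> B) < p_domination_number p V E"]]
    unfolding p_reinforcement_number_def by auto
  then show thesis
    using that by auto
qed

text \<open>A bound on \<open>card B\<close>, rather than its exact value, is enough to bound the
  minimum \<open>p_reinforcement_number\<close> from above.\<close>

lemma mu_vertex_edges_reinforce:
  assumes "finite_simple_graph V E" "is_gamma_set p V E X" "x \<in> X" "p < card X"
  obtains B where "B \<subseteq> complement_edges V E" "card B \<le> mu_vertex p V E x X"
    "p_domination_number p V (E \<union> B) < p_domination_number p V E"
proof -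
  define P where "P = private_neighbours p V E x X"
  define D where "D = X - {x}"
  have finV: "finite V" and edge: "\<And>e. e \<in> E \<Longrightarrow> card e = 2"
    using assms(1) by (auto simp: finite_simple_graph_def)
  have dom: "X \<subseteq> V" "\<And>y. y \<in> V - X \<Longrightarrow> p \<le> card (neighbourhood E y \<inter> X)"
    using assms(2) by (auto simp: is_gamma_set_def p_dominating_def)
  have finX: "finite X"
    using dom(1) finV finite_subset by blast
  have finP: "finite P"
    using finV by (simp add: P_def private_neighbours_def)
  have cardD: "p \<le> card D" "card D < card X"
    using assms(3,4) finX by (auto simp: D_def card_gt_0_iff)
  \<comment> \<open>There are no loops, so \<open>x\<close> is not its own neighbour.\<close>
  have NxX: "neighbourhood E x \<inter> X = neighbourhood E x \<inter> D"
    using edge[of "{x}"] by (auto simp: D_def neighbourhood_def)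
  \<comment> \<open>A private neighbour adjacent to all of \<open>X\<close> would give
    \<open>card X = p\<close>, against \<open>p < card X\<close>.\<close>
  have "\<exists>z. z \<in> X - neighbourhood E y" if "y \<in> P" for y
  proof (rule ccontr)
    assume "\<not> ?thesis"
    then have "neighbourhood E y \<inter> X = X"
      by auto
    then show False
      using that assms(4) by (simp add: P_def private_neighbours_def)
  qed
  then obtain z where z: "\<And>y. y \<in> P \<Longrightarrow> z y \<in> X - neighbourhood E y"
    by metis
  \<comment> \<open>\<open>z y\<close> differs from \<open>x\<close> because \<open>x\<close> is a
    neighbour of \<open>y\<close>; hence the new edge at \<open>y\<close> ends in a vertex that
    survives the removal of \<open>x\<close>.\<close>
  have zD: "z y \<in> D" "y \<in> V - X" "{y, z y} \<notin> E" if "y \<in> P" for y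
    using z[OF that] that
    by (auto simp: D_def P_def private_neighbours_def neighbourhood_def insert_commute)
  have "p - card (neighbourhood E x \<inter> X) \<le> card (D - neighbourhood E x)"
  proof -
    have "card (D - neighbourhood E x) = card D - card (neighbourhood E x \<inter> D)"
      using card_Diff_subset_Int[of D "neighbourhood E x"] finX
      by (simp add: D_def Int_commute)
    then show ?thesis
      using cardD NxX by simp
  qed
  then obtain S where S: "S \<subseteq> D - neighbourhood E x"
      "card S = p - card (neighbourhood E x \<inter> X)" "finite S"
    by (rule obtain_subset_with_card_n)
  define B where "B = (\<lambda>y. {y, z y}) ` P \<union> (\<lambda>s. {x, s}) ` S"
  have "card B \<le> card ((\<lambda>y. {y, z y}) ` P) + card ((\<lambda>s. {x, s}) ` S)"
    unfolding B_def by (rule card_Un_le)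
  also have "\<dots> \<le> card P + card S"
    using finP S(3) by (intro add_mono card_image_le)
  also have "\<dots> = mu_vertex p V E x X"
    by (simp add: mu_vertex_def P_def S(2))
  finally have cardB: "card B \<le> mu_vertex p V E x X" .
  have BE: "B \<subseteq> complement_edges V E"
  proof -
    have "{y, z y} \<in> complement_edges V E" if "y \<in> P" for y
      using zD[OF that] dom(1) by (auto simp: complement_edges_def D_def card_insert_if)
    moreover have "{x, s} \<in> complement_edges V E" if "s \<in> S" for s
      using that S(1) dom(1) assms(3)
      by (auto simp: complement_edges_def D_def neighbourhood_def card_insert_if)
    ultimately show ?thesis
      by (auto simp: B_def)
  qed
  have finD: "finite (M \<inter> D)" for M
    using finX by (simp add: D_def)
  have "p \<le> card (neighbourhood (E \<union> B) y \<inter> D)" if y: "y \<in> V - D" for y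
  proof -
    have mono: "neighbourhood E y \<inter> D \<subseteq> neighbourhood (E \<union> B) y \<inter> D"
      by (auto simp: neighbourhood_def)
    \<comment> \<open>The first two cases are the vertices that new edges repair. A non-private
      neighbour of \<open>x\<close> outside \<open>X\<close> has a neighbour in \<open>X\<close> to
      spare, and a non-neighbour loses nothing.\<close>
    consider "y = x" | "y \<in> P" | "y \<in> V - X" "y \<notin> P" "{x, y} \<in> E"
      | "y \<in> V - X" "{x, y} \<notin> E"
      using y by (auto simp: D_def)
    then show ?thesis
    proof cases
      case 1
      have "p \<le> card (neighbourhood E x \<inter> D) + card S"
        using S(2) NxX by simp
      also have "\<dots> = card (neighbourhood E x \<inter> D \<union> S)"
        using S finD by (intro card_Un_disjoint[symmetric]) auto
      also have "\<dots> \<le> card (neighbourhood (E \<union> B) x \<inter> D)"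
        using S by (intro card_mono finD) (auto simp: neighbourhood_def B_def)
      finally show ?thesis
        using 1 by simp
    next
      case 2
      have eq: "neighbourhood E y \<inter> D = neighbourhood E y \<inter> X - {x}"
        by (auto simp: D_def)
      have "x \<in> neighbourhood E y \<inter> X" "card (neighbourhood E y \<inter> X) = p"
        using 2 assms(3)
        by (auto simp: P_def private_neighbours_def neighbourhood_def insert_commute)
      \<comment> \<open>The removal of \<open>x\<close> costs \<open>y\<close> exactly one
        neighbour, which \<open>z y\<close> replaces.\<close>
      then have "p = Suc (card (neighbourhood E y \<inter> D))"
        unfolding eq using finX card_Suc_Diff1[of "neighbourhood E y \<inter> X" x] by simp
      also have "\<dots> = card (insert (z y) (neighbourhood E y \<inter> D))"
        using zD[OF 2] finD by (simp add: neighbourhood_def)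
      also have "\<dots> \<le> card (neighbourhood (E \<union> B) y \<inter> D)"
        using zD[OF 2] 2 by (intro card_mono finD) (auto simp: neighbourhood_def B_def)
      finally show ?thesis .
    next
      case 3
      have eq: "neighbourhood E y \<inter> D = neighbourhood E y \<inter> X - {x}"
        by (auto simp: D_def)
      have "p < card (neighbourhood E y \<inter> X)"
        using 3 dom(2)[of y] by (auto simp: P_def private_neighbours_def)
      also have "\<dots> \<le> Suc (card (neighbourhood E y \<inter> D))"
        unfolding eq using diff_card_le_card_Diff[of "{x}" "neighbourhood E y \<inter> X"] by simp
      finally show ?thesis
        using card_mono[OF finD mono] by simp
    next
      case 4
      then have "neighbourhood E y \<inter> D = neighbourhood E y \<inter> X"
        by (auto simp: D_def neighbourhood_def insert_commute)
      then show ?thesis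
        using dom(2)[of y] 4 card_mono[OF finD mono] by simp
    qed
  qed
  then have "p_dominating p V (E \<union> B) D"
    using dom(1) by (auto simp: p_dominating_def D_def)
  then have "p_domination_number p V (E \<union> B) < p_domination_number p V E"
    using p_domination_number_le[OF finV] cardD(2) assms(2)
    by (fastforce simp: is_gamma_set_def)
  then show thesis
    using that BE cardB by blast
qed

text \<open>The vertex \<open>u\<close> is one that \<open>D\<close> fails to dominate without
  \<open>e\<close>. Adding it to \<open>D\<close> removes that failure at the cost of one vertex,
  which is just the gain that \<open>e\<close> brought.\<close>

lemma single_edge_gives_mu_vertex_one:
  assumes "finite_simple_graph V E" "e \<in> complement_edges V E"
    and less: "p_domination_number p V (insert e E) < p_domination_number p V E"
  obtains X u where "is_gamma_set p V E X" "u \<in> X" "mu_vertex p V E u X = 1"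
proof -
  have finV: "finite V" and edge: "\<And>e. e \<in> E \<Longrightarrow> card e = 2"
    using assms(1) by (auto simp: finite_simple_graph_def)
  obtain D where D: "is_gamma_set p V (insert e E) D"
    using gamma_set_exists[OF finV] .
  have DV: "D \<subseteq> V" and domD: "\<And>y. y \<in> V - D \<Longrightarrow> p \<le> card (neighbourhood (insert e E) y \<inter> D)"
    and cardD: "card D < p_domination_number p V E"
    using D less by (auto simp: is_gamma_set_def p_dominating_def)
  have finD: "finite D"
    using DV finV finite_subset by blast
  have "\<not> p_dominating p V E D"
    using p_domination_number_le[OF finV, of p E D] cardD by auto
  then obtain u where u: "u \<in> V - D" "card (neighbourhood E u \<inter> D) < p"
    using DV by (auto simp: p_dominating_def not_le)
  \<comment> \<open>The count at \<open>u\<close> reaches \<open>p\<close> only once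
    \<open>e\<close> is present, so \<open>e\<close> must join \<open>u\<close> to a vertex of
    \<open>D\<close>.\<close>
  have "neighbourhood (insert e E) u \<inter> D \<noteq> neighbourhood E u \<inter> D"
    using domD[OF u(1)] u(2) by auto
  then obtain v where v: "v \<in> D" "e = {u, v}"
    by (auto simp: neighbourhood_def)
  have Nu: "neighbourhood (insert e E) u \<inter> D \<subseteq> insert v (neighbourhood E u \<inter> D)"
    using v by (auto simp: neighbourhood_def doubleton_eq_iff)
  have "p \<le> card (insert v (neighbourhood E u \<inter> D))"
    using domD[OF u(1)] card_mono[OF _ Nu] finD by simp
  \<comment> \<open>One edge adds at most one neighbour, so \<open>u\<close> falls short of
    \<open>p\<close> by exactly one.\<close>
  then have pu: "p = Suc (card (neighbourhood E u \<inter> D))"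
    using u(2) finD by (simp add: card_insert_if split: if_splits)
  \<comment> \<open>A vertex outside \<open>D\<close> other than \<open>u\<close> is not an end of
    \<open>e\<close>, as \<open>v\<close> lies in \<open>D\<close>.\<close>
  have Ny: "neighbourhood (insert e E) y \<inter> D = neighbourhood E y \<inter> D"
    if "y \<in> V - insert u D" for y
    using that v by (auto simp: neighbourhood_def doubleton_eq_iff)
  define X where "X = insert u D"
  have domX: "p_dominating p V E X"
    unfolding p_dominating_def
  proof (intro conjI ballI)
    show "X \<subseteq> V"
      using DV u by (simp add: X_def)
    fix y assume y: "y \<in> V - X"
    have "p \<le> card (neighbourhood E y \<inter> D)"
      using domD[of y] Ny[of y] y by (simp add: X_def)
    also have "\<dots> \<le> card (neighbourhood E y \<inter> X)"
      using finD by (intro card_mono) (auto simp: X_def)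
    finally show "p \<le> card (neighbourhood E y \<inter> X)" .
  qed
  \<comment> \<open>Here \<open>card X = card D + 1\<close> is at most the domination number of the
    original graph, and at least that since \<open>X\<close> dominates.\<close>
  have gX: "is_gamma_set p V E X"
    using domX p_domination_number_le[OF finV domX] cardD u(1) finD
    by (simp add: is_gamma_set_def X_def)
  \<comment> \<open>A private neighbour of \<open>u\<close> would have only \<open>p - 1\<close>
    neighbours in \<open>D\<close>, yet \<open>D\<close> dominates it without the help of
    \<open>e\<close>.\<close>
  have "private_neighbours p V E u X = {}"
  proof (rule ccontr)
    assume "\<not> ?thesis"
    then obtain y where y: "y \<in> V - X" "{u, y} \<in> E" "card (neighbourhood E y \<inter> X) = p"
      by (auto simp: private_neighbours_def)
    have "neighbourhood E y \<inter> X = insert u (neighbourhood E y \<inter> D)"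
      using y(2) by (auto simp: X_def neighbourhood_def insert_commute)
    then have "p = Suc (card (neighbourhood E y \<inter> D))"
      using y(3) u(1) finD by simp
    then show False
      using domD[of y] Ny[of y] y(1) by (simp add: X_def)
  qed
  \<comment> \<open>With no loop at \<open>u\<close>, its deficiency with respect to
    \<open>X\<close> is still the one found in \<open>pu\<close>.\<close>
  moreover have "neighbourhood E u \<inter> X = neighbourhood E u \<inter> D"
    using edge[of "{u}"] by (auto simp: X_def neighbourhood_def)
  ultimately have "mu_vertex p V E u X = 1"
    using pu by (simp add: mu_vertex_def)
  then show thesis
    using that[OF gX, of u] by (simp add: X_def)
qed

theorem theorem5p1:
  fixes V :: "'a set" and E :: "'a set set" and p :: nat
  assumes "finite_simple_graph V E" and "E \<noteq> {}" and "p \<ge> 1"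
  shows "p_reinforcement_number p V E \<le> mu_graph p V E \<and>
    (p_reinforcement_number p V E = 1 \<longrightarrow>
       p_reinforcement_number p V E = mu_graph p V E)"
proof (cases "p_domination_number p V E \<le> p")
  \<comment> \<open>By convention the reinforcement number is 0 here, so the inequality is trivial
    and the implication vacuous.\<close>
  case True
  then show ?thesis
    by (simp add: p_reinforcement_number_def)
next
  case False
  have finV: "finite V"
    using assms(1) by (simp add: finite_simple_graph_def)
  obtain X x where X: "is_gamma_set p V E X" "x \<in> X" "mu_graph p V E = mu_vertex p V E x X"
    using mu_graph_attained[OF finV, of p E] False by (metis gr0I le0)
  have "p < card X"
    using X(1) False by (simp add: is_gamma_set_def)
  then obtain B where B: "B \<subseteq> complement_edges V E" "card B \<le> mu_vertex p V E x X"
      "p_domination_number p V (E \<union> B) < p_domination_number p V E"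
    using mu_vertex_edges_reinforce[OF assms(1) X(1,2)] by blast
  have le: "p_reinforcement_number p V E \<le> mu_graph p V E"
    using p_reinforcement_number_le[OF finV B(1,3)] B(2) X(3) by simp
  moreover have "mu_graph p V E \<le> 1" if r1: "p_reinforcement_number p V E = 1"
  proof -
    \<comment> \<open>The set \<open>B\<close> built for the inequality also ensures that the
      minimum is attained.\<close>
    obtain C where C: "C \<subseteq> complement_edges V E" "card C = 1"
      "p_domination_number p V (E \<union> C) < p_domination_number p V E"
      using p_reinforcement_number_attained[OF finV _ B(1,3)] False r1
      unfolding not_le by metis
    obtain e where "C = {e}"
      using C(2) card_1_singletonE by blast
    then obtain Y u where "is_gamma_set p V E Y" "u \<in> Y" "mu_vertex p V E u Y = 1"
      using single_edge_gives_mu_vertex_one[OF assms(1), of e p] C(1,3)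
      by (metis Un_insert_right insert_subset sup_bot_right)
    then show ?thesis
      using mu_graph_le_mu_vertex[OF finV] by metis
  qed
  ultimately show ?thesis
    by auto
qed

end
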